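(* Let $n\ge 1$ and consider a transversal design $\mathrm{TD}(2,n)$. Xeno (the first player) has a winning strategy in Tic-Tac-Toe on it if and only if $n\ge 2$.
   Context: A transversal design $\mathrm{TD}(k,n)$ is a triple $(X,\mathcal{G},\mathcal{B})$ where $X$ is a set of $kn$ points, $\mathcal{G}$ is a partition of $X$ into $k$ subsets of cardinality $n$ (the groups), and $\mathcal{B}$ is a set of $k$-element subsets of $X$ (the blocks) such that every pair of points not in the same group appears in exactly one block, and no block contains two points of the same group. Tic-Tac-Toe on a design: two players, Xeno (first) and Ophelia (second), alternately choose points not chosen before; the first player to have chosen all the points of some block wins. If all points are chosen and nobody has completed a block, the game is a draw. Only the blocks (not the groups) are winning sets. *)

theory Defs
  imports Main "HOL-Library.Disjoint_Sets"
begin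

definition transversal_design ::
  "nat \<Rightarrow> nat \<Rightarrow> 'a set \<Rightarrow> 'a set set \<Rightarrow> 'a set set \<Rightarrow> bool" where
  "transversal_design k n X \<G> \<B> \<longleftrightarrow>
     finite X \<and> card X = k * n \<and>
     partition_on X \<G> \<and> card \<G> = k \<and> (\<forall>g\<in>\<G>. card g = n) \<and>
     (\<forall>b\<in>\<B>. b \<subseteq> X \<and> card b = k) \<and>
     (\<forall>x\<in>X. \<forall>y\<in>X. \<not> (\<exists>g\<in>\<G>. x \<in> g \<and> y \<in> g) \<longrightarrow> (\<exists>!b. b \<in> \<B> \<and> x \<in> b \<and> y \<in> b)) \<and>
     (\<forall>b\<in>\<B>. \<forall>g\<in>\<G>. \<not> (\<exists>x y. x \<noteq> y \<and> x \<in> b \<inter> g \<and> y \<in> b \<inter> g))"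

text \<open>
  A position of the game is the list of the points chosen so far, in chronological order.
  Indices start at 0, so the first player Xeno owns the points at even indices and
  the second player Ophelia those at odd indices; Xeno is to move iff the length is even.
\<close>

definition xeno_points :: "'a list \<Rightarrow> 'a set" where
  "xeno_points p = {p ! i | i. i < length p \<and> even i}"

definition ophelia_points :: "'a list \<Rightarrow> 'a set" where
  "ophelia_points p = {p ! i | i. i < length p \<and> odd i}"

definition has_block :: "'a set set \<Rightarrow> 'a set \<Rightarrow> bool" where
  "has_block \<B> S \<longleftrightarrow> (\<exists>b\<in>\<B>. b \<subseteq> S)"

definition game_over :: "'a set \<Rightarrow> 'a set set \<Rightarrow> 'a list \<Rightarrow> bool" where
  "game_over X \<B> p \<longleftrightarrow>
     has_block \<B> (xeno_points p) \<or> has_block \<B> (ophelia_points p) \<or> set p = X"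

inductive legal_play :: "'a set \<Rightarrow> 'a set set \<Rightarrow> 'a list \<Rightarrow> bool" for X \<B> where
  start: "legal_play X \<B> []"
| move: "legal_play X \<B> p \<Longrightarrow> \<not> game_over X \<B> p \<Longrightarrow> x \<in> X - set p \<Longrightarrow> legal_play X \<B> (p @ [x])"

text \<open>
  A legal play stops as soon as one player has completed a block. Hence (blocks being
  nonempty) at the end of a legal play at most one player has a block, and that player
  was the first to complete one.
\<close>

definition xeno_wins :: "'a set \<Rightarrow> 'a set set \<Rightarrow> 'a list \<Rightarrow> bool" where
  "xeno_wins X \<B> p \<longleftrightarrow> legal_play X \<B> p \<and> has_block \<B> (xeno_points p)"

text \<open>
  A strategy must prescribe an unchosen point wherever Xeno has to move; otherwise one
  that prescribes an illegal move would have no complete plays and win vacuously.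
\<close>

definition xeno_strategy :: "'a set \<Rightarrow> 'a set set \<Rightarrow> ('a list \<Rightarrow> 'a) \<Rightarrow> bool" where
  "xeno_strategy X \<B> \<sigma> \<longleftrightarrow>
     (\<forall>p. legal_play X \<B> p \<and> \<not> game_over X \<B> p \<and> even (length p) \<longrightarrow> \<sigma> p \<in> X - set p)"

definition xeno_follows :: "('a list \<Rightarrow> 'a) \<Rightarrow> 'a list \<Rightarrow> bool" where
  "xeno_follows \<sigma> p \<longleftrightarrow> (\<forall>i < length p. even i \<longrightarrow> p ! i = \<sigma> (take i p))"

definition xeno_has_winning_strategy :: "'a set \<Rightarrow> 'a set set \<Rightarrow> bool" where
  "xeno_has_winning_strategy X \<B> \<longleftrightarrow>
     (\<exists>\<sigma>. xeno_strategy X \<B> \<sigma> \<and>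
        (\<forall>p. legal_play X \<B> p \<and> game_over X \<B> p \<and> xeno_follows \<sigma> p \<longrightarrow> xeno_wins X \<B> p))"

end

theory Submission
  imports Defs
begin

text \<open>
  The blocks of a \<open>TD(2,n)\<close> are the pairs of points from different groups. If \<open>n \<ge> 2\<close>, Xeno's
  first point lies in two blocks, and Ophelia's first move spoils only one of them, so Xeno
  completes the other on his second move, when Ophelia has a single point. If \<open>n = 1\<close>, there
  are only two points and Xeno gets only one of them.
\<close>

lemma legal_play_distinct: "legal_play X \<B> p \<Longrightarrow> distinct p \<and> set p \<subseteq> X"
  by (induction rule: legal_play.induct) auto

lemma card_xeno_points_le_1: "length p \<le> 2 \<Longrightarrow> card (xeno_points p) \<le> 1"
proof -
  assume "length p \<le> 2"
  then have "i = 0" if "i < length p" "even i" for i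
    using that by presburger
  then have "xeno_points p \<subseteq> {p ! 0}"
    unfolding xeno_points_def by blast
  then have "card (xeno_points p) \<le> card {p ! 0}" by (rule card_mono[rotated]) simp
  then show ?thesis by simp
qed

lemma card_ophelia_points_le_1: "length p \<le> 2 \<Longrightarrow> card (ophelia_points p) \<le> 1"
proof -
  assume "length p \<le> 2"
  then have "i = 1" if "i < length p" "odd i" for i
    using that by presburger
  then have "ophelia_points p \<subseteq> {p ! 1}"
    unfolding ophelia_points_def by blast
  then have "card (ophelia_points p) \<le> card {p ! 1}" by (rule card_mono[rotated]) simp
  then show ?thesis by simp
qed

lemma not_has_block_card_le_1:
  assumes "\<forall>b\<in>\<B>. card b = 2" "finite S" "card S \<le> 1"
  shows "\<not> has_block \<B> S"
proof
  assume "has_block \<B> S"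
  then obtain b where "b \<in> \<B>" "b \<subseteq> S" unfolding has_block_def by blast
  then have "2 \<le> card S" using assms(1) card_mono[OF assms(2)] by metis
  then show False using assms(3) by simp
qed

lemma finite_xeno_points: "finite (xeno_points p)"
  and finite_ophelia_points: "finite (ophelia_points p)"
  by (simp_all add: xeno_points_def ophelia_points_def)

text \<open>Each player owns at most one of the first two points, but a block needs two. A play this
  short can thus be over only because \<open>X\<close> is exhausted.\<close>

lemma not_has_block_short_play:
  assumes "\<forall>b\<in>\<B>. card b = 2" "length p \<le> 2"
  shows "\<not> has_block \<B> (xeno_points p)" "\<not> has_block \<B> (ophelia_points p)"
  using not_has_block_card_le_1[OF assms(1) finite_xeno_points card_xeno_points_le_1[OF assms(2)]]
    not_has_block_card_le_1[OF assms(1) finite_ophelia_points card_ophelia_points_le_1[OF assms(2)]]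
  by this

text \<open>Opening at \<open>x\<close> creates a double threat: Ophelia's single reply cannot
  occupy both \<open>y\<close> and \<open>z\<close>.\<close>

lemma xeno_wins_if_point_in_two_blocks:
  assumes blocks: "\<forall>b\<in>\<B>. b \<subseteq> X \<and> card b = 2"
    and xy: "{x, y} \<in> \<B>" and xz: "{x, z} \<in> \<B>" and "y \<noteq> z" and "finite X"
  shows "xeno_has_winning_strategy X \<B>"
proof -
  \<comment> \<open>If \<open>x\<close> equalled \<open>y\<close> or \<open>z\<close>, the
    corresponding block would be a singleton.\<close>
  have neq: "x \<noteq> y" "x \<noteq> z" using blocks xy xz by force+
  have X: "{x, y, z} \<subseteq> X" using blocks xy xz by blast
  \<comment> \<open>Any \<open>u\<close> completing a block with \<open>x\<close> will do, so
    Ophelia's reply needs no case split here. The last case never arises in play following \<sigma>;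
    it keeps \<sigma> legal at the other positions, which \<open>xeno_strategy\<close> also
    covers.\<close>
  define \<sigma> where "\<sigma> p = (if p = [] then x
      else if \<exists>u \<in> X - set p. {x, u} \<in> \<B> then SOME u. u \<in> X - set p \<and> {x, u} \<in> \<B>
      else SOME u. u \<in> X - set p)" for p
  have completes: "\<sigma> p \<in> X - set p \<and> {x, \<sigma> p} \<in> \<B>"
    if "p \<noteq> []" "\<exists>u \<in> X - set p. {x, u} \<in> \<B>" for p
    using someI_ex[of "\<lambda>u. u \<in> X - set p \<and> {x, u} \<in> \<B>"] that by (auto simp: \<sigma>_def)
  have "xeno_strategy X \<B> \<sigma>"
    unfolding xeno_strategy_def
  proof (intro allI impI)
    fix p
    assume p: "legal_play X \<B> p \<and> \<not> game_over X \<B> p \<and> even (length p)"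
    then have "X - set p \<noteq> {}" using legal_play_distinct[of X \<B> p] by (auto simp: game_over_def)
    then have "(SOME u. u \<in> X - set p) \<in> X - set p" by (meson ex_in_conv someI_ex)
    then show "\<sigma> p \<in> X - set p" using completes[of p] X by (auto simp: \<sigma>_def)
  qed
  moreover have "xeno_wins X \<B> p"
    if p: "legal_play X \<B> p" "game_over X \<B> p" "xeno_follows \<sigma> p" for p
  proof -
    \<comment> \<open>Two moves complete no block and cannot exhaust \<open>X\<close>, which
      contains the three points \<open>x\<close>, \<open>y\<close>, \<open>z\<close>.\<close>
    have len: "2 < length p"
    proof (rule ccontr)
      assume "\<not> 2 < length p"
      then have le: "length p \<le> 2" by simp
      then have "set p = X" using p(2) not_has_block_short_play[of \<B> p] blocks
        by (auto simp: game_over_def)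
      then have "card {x, y, z} \<le> length p"
        using X card_mono[of X "{x, y, z}"] \<open>finite X\<close> card_length[of p] by simp
      then show False using le neq \<open>y \<noteq> z\<close> by simp
    qed
    have "p ! 0 = \<sigma> []" using p(3) len by (force simp: xeno_follows_def)
    then have p0: "p ! 0 = x" by (simp add: \<sigma>_def)
    have take: "take 2 p = [x, p ! 1]" using len p0
      by (cases p; cases "tl p") auto
    \<comment> \<open>If Ophelia took \<open>y\<close>, the witness is \<open>z\<close>; otherwise
      it is \<open>y\<close>.\<close>
    have "\<exists>u \<in> X - set (take 2 p). {x, u} \<in> \<B>"
      using X neq \<open>y \<noteq> z\<close> xy xz unfolding take by (cases "p ! 1 = y") auto
    moreover have "p ! 2 = \<sigma> (take 2 p)" using p(3) len by (simp add: xeno_follows_def)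
    ultimately have "{p ! 0, p ! 2} \<in> \<B>" using completes[of "take 2 p"] take p0 by simp
    \<comment> \<open>Both indices are even. Owning this block already makes \<open>p\<close> a win,
      so the exact length of \<open>p\<close> need not be found.\<close>
    moreover have "{p ! 0, p ! 2} \<subseteq> xeno_points p"
      using len by (fastforce simp: xeno_points_def)
    ultimately show ?thesis using p(1) unfolding xeno_wins_def has_block_def by blast
  qed
  ultimately show ?thesis unfolding xeno_has_winning_strategy_def by blast
qed

text \<open>Ophelia's forced reply to any opening uses up \<open>X\<close> with one point for each
  player, so the complete play is a draw.\<close>

lemma not_xeno_has_winning_strategy_two_points:
  assumes blocks: "\<forall>b\<in>\<B>. card b = 2" and X: "card X = 2"
  shows "\<not> xeno_has_winning_strategy X \<B>"
proof
  assume "xeno_has_winning_strategy X \<B>"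
  then obtain \<sigma> where strategy: "xeno_strategy X \<B> \<sigma>"
    and wins: "\<And>p. legal_play X \<B> p \<Longrightarrow> game_over X \<B> p \<Longrightarrow> xeno_follows \<sigma> p \<Longrightarrow> xeno_wins X \<B> p"
    unfolding xeno_has_winning_strategy_def by blast
  have not_over: "\<not> game_over X \<B> p" if "length p < 2" for p
    using that not_has_block_short_play[OF blocks, of p] card_length[of p] X
    by (auto simp: game_over_def)
  have start: "\<sigma> [] \<in> X"
    using strategy not_over[of "[]"] legal_play.start by (force simp: xeno_strategy_def)
  then obtain y where y: "X = {\<sigma> [], y}" "y \<noteq> \<sigma> []"
    using X by (auto simp: card_2_iff)
  have "legal_play X \<B> [\<sigma> []]"
    using legal_play.move[OF legal_play.start not_over[of "[]"]] start by simp
  then have "legal_play X \<B> [\<sigma> [], y]"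
    using legal_play.move[OF _ not_over[of "[\<sigma> []]"], of y] y by simp
  moreover have "game_over X \<B> [\<sigma> [], y]" using y by (simp add: game_over_def)
  \<comment> \<open>Only index 0 is constrained, and there the prefix is empty.\<close>
  moreover have "xeno_follows \<sigma> [\<sigma> [], y]"
    by (auto simp: xeno_follows_def less_Suc_eq)
  ultimately have "xeno_wins X \<B> [\<sigma> [], y]" by (rule wins)
  then show False using not_has_block_short_play[OF blocks, of "[\<sigma> [], y]"]
    by (simp add: xeno_wins_def)
qed

text \<open>A point \<open>x\<close> of one group forms a block with every point of the other group,
  which has at least two points.\<close>

lemma transversal_design_2_point_in_two_blocks:
  assumes td: "transversal_design 2 n X \<G> \<B>" and "n \<ge> 2"
  obtains x y z where "{x, y} \<in> \<B>" "{x, z} \<in> \<B>" "y \<noteq> z"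
proof -
  note td' = td[unfolded transversal_design_def]
  have part: "partition_on X \<G>" and "card \<G> = 2" and size: "\<forall>g\<in>\<G>. card g = n"
    and blocks: "\<forall>b\<in>\<B>. b \<subseteq> X \<and> card b = 2"
    and "\<forall>u\<in>X. \<forall>v\<in>X. \<not> (\<exists>g\<in>\<G>. u \<in> g \<and> v \<in> g) \<longrightarrow> (\<exists>!b. b \<in> \<B> \<and> u \<in> b \<and> v \<in> b)"
    using td' by - (elim conjE, assumption)+
  from this(5) have ex: "\<exists>b. b \<in> \<B> \<and> u \<in> b \<and> v \<in> b"
    if "u \<in> X" "v \<in> X" "\<not> (\<exists>g\<in>\<G>. u \<in> g \<and> v \<in> g)" for u v
    using that by (blast dest: ex1_implies_ex)
  obtain g h where gh: "\<G> = {g, h}" "g \<noteq> h" using \<open>card \<G> = 2\<close> by (auto simp: card_2_iff)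
  have disj: "g \<inter> h = {}" and X: "X = g \<union> h"
    using part gh by (auto simp: partition_on_def disjoint_def)
  \<comment> \<open>The block covering \<open>u\<close> and \<open>v\<close> has exactly two
    elements, so it is \<open>{u, v}\<close> itself.\<close>
  have pair: "{u, v} \<in> \<B>" if uv: "u \<in> g" "v \<in> h" for u v
  proof -
    have "\<not> (\<exists>k\<in>\<G>. u \<in> k \<and> v \<in> k)" using uv disj gh by auto
    then obtain b where b: "b \<in> \<B>" "u \<in> b" "v \<in> b" using ex[of u v] X uv by blast
    moreover have "u \<noteq> v" using uv disj by auto
    moreover obtain c d where "b = {c, d}" using blocks b(1) by (meson card_2_iff)
    ultimately have "b = {u, v}" by auto
    then show ?thesis using b by simp
  qed
  have "card g \<ge> 2" "card h \<ge> 2" using size gh \<open>n \<ge> 2\<close> by auto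
  \<comment> \<open>Finiteness of \<open>h\<close> follows from its positive cardinality, as
    \<open>card\<close> is 0 on infinite sets.\<close>
  then have "g \<noteq> {}" "\<not> card h \<le> Suc 0" "finite h"
    using card_ge_0_finite[of h] by auto
  then obtain x where "x \<in> g" by blast
  moreover obtain y z where "y \<in> h" "z \<in> h" "y \<noteq> z"
    using \<open>\<not> card h \<le> Suc 0\<close> card_le_Suc0_iff_eq[OF \<open>finite h\<close>] by blast
  ultimately show ?thesis using pair that by blast
qed

theorem theorem3p6:
  fixes n :: nat and X :: "'a set" and \<G> \<B> :: "'a set set"
  assumes "n \<ge> 1"
    and "transversal_design 2 n X \<G> \<B>"
  shows "xeno_has_winning_strategy X \<B> \<longleftrightarrow> n \<ge> 2"
proof
  have blocks: "\<forall>b\<in>\<B>. b \<subseteq> X \<and> card b = 2" and X: "finite X" "card X = 2 * n"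
    using assms(2) by (simp_all add: transversal_design_def)
  show "n \<ge> 2" if "xeno_has_winning_strategy X \<B>"
  proof (rule ccontr)
    assume "\<not> n \<ge> 2"
    then have "card X = 2" using X \<open>n \<ge> 1\<close> by simp
    then show False using not_xeno_has_winning_strategy_two_points[of \<B> X] blocks that by blast
  qed
  show "xeno_has_winning_strategy X \<B>" if "n \<ge> 2"
  proof -
    obtain x y z where "{x, y} \<in> \<B>" "{x, z} \<in> \<B>" "y \<noteq> z"
      by (rule transversal_design_2_point_in_two_blocks[OF assms(2) \<open>n \<ge> 2\<close>])
    then show ?thesis
      using xeno_wins_if_point_in_two_blocks[OF blocks _ _ _ \<open>finite X\<close>] by blast
  qed
qed

end
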